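(* Consider $n\in\mathbb{N}$ receivers with (possibly different) reception probabilities $q_1,\ldots,q_n$ and infinite field size. Consider any sample path (realization) $\omega\in\Omega$ of erasures and nonerasures to each receiver over the sequence of transmissions. Let $c<c'$ and $m$ be positive integers, and let $T_{n:n}^{(c,m)}(\omega)$ and $T_{n:n}^{(c',m)}(\omega)$ be the total time to complete the transmission of a workload of $m$ packets under blocklengths $c$ and $c'$ respectively. Then: (i) if $m\le c'$, then $T_{n:n}^{(c',m)}(\omega)\le T_{n:n}^{(c,m)}(\omega)$ for all $\omega\in\Omega$; (ii) if $m>c'$, then $T_{n:n}^{(c',m)}(\omega)\le T_{n:n}^{(c,m)}(\omega)$ for all $\omega\in\Omega$ if and only if $c'=kc$ for some integer $k\ge2$.
   Context: $\mathbb{N}=\{1,2,\ldots\}$. A realization $\omega$ specifies, for each receiver $j$ and each time slot $t\in\{1,2,\ldots\}$, whether the transmission in slot $t$ is received (success) or erased (failure) at receiver $j$; $\Omega$ is the set of realizations. Since the field size is infinite, every reception is useful to a receiver until it completes its current block, so the only randomness is in the erasures. With blocklength $c$, the $m$ packets are split into $\lceil m/c\rceil$ consecutive blocks, all of size $c$ except that the last may be a partial block holding the remaining packets. Blocks are transmitted sequentially: with $\tau_0=0$, block $i$ (of size $b_i$) completes at the first time $\tau_i$ such that every receiver has at least $b_i$ successes in slots $\tau_{i-1}+1,\ldots,\tau_i$ (additional successes of a receiver within a block are not useful and do not carry over), and $T_{n:n}^{(c,m)}(\omega)=\tau_{\lceil m/c\rceil}$.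
   Formalization: The "only if" in (ii) is stated for n ≥ 2 receivers, since it fails for n = 1 (e.g. c=2, c'=3, m=4: both times equal the slot of the m-th success); part (i) and the "if" in (ii) hold for all n ≥ 1. *)

theory Defs
  imports Complex_Main "HOL-Library.Extended_Nat"
begin

text \<open>
  \<open>\<omega> j t\<close> means that receiver \<open>j\<close> receives the transmission in slot \<open>t\<close>. Receivers are
  \<open>1, \<dots>, n\<close> and slots are \<open>1, 2, \<dots>\<close>; the values of \<open>\<omega>\<close> elsewhere are never inspected,
  so quantifying over the whole type ranges over all realizations.
\<close>

type_synonym realization = "nat \<Rightarrow> nat \<Rightarrow> bool"

definition successes :: "realization \<Rightarrow> nat \<Rightarrow> nat \<Rightarrow> nat \<Rightarrow> nat" where
  "successes \<omega> j s t = card {u \<in> {s<..t}. \<omega> j u}"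

definition num_blocks :: "nat \<Rightarrow> nat \<Rightarrow> nat" where
  "num_blocks c m = nat \<lceil>real m / real c\<rceil>"

definition block_size :: "nat \<Rightarrow> nat \<Rightarrow> nat \<Rightarrow> nat" where
  "block_size c m i = (if i < num_blocks c m then c else m - (num_blocks c m - 1) * c)"

text \<open>
  A realization need not contain enough successes for a block ever to complete, so completion
  times are extended naturals: the infimum of the empty set is \<open>\<infinity>\<close>.
\<close>

definition block_end :: "nat \<Rightarrow> realization \<Rightarrow> nat \<Rightarrow> nat \<Rightarrow> enat" where
  "block_end n \<omega> b s = Inf {enat t |t. s \<le> t \<and> (\<forall>j\<in>{1..n}. b \<le> successes \<omega> j s t)}"

primrec block_time :: "nat \<Rightarrow> realization \<Rightarrow> nat \<Rightarrow> nat \<Rightarrow> nat \<Rightarrow> enat" where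
  "block_time n \<omega> c m 0 = 0"
| "block_time n \<omega> c m (Suc i) =
     (case block_time n \<omega> c m i of
        enat s \<Rightarrow> block_end n \<omega> (block_size c m (Suc i)) s
      | \<infinity> \<Rightarrow> \<infinity>)"

definition total_time :: "nat \<Rightarrow> realization \<Rightarrow> nat \<Rightarrow> nat \<Rightarrow> enat" where
  "total_time n \<omega> c m = block_time n \<omega> c m (num_blocks c m)"

end

theory Submission
  imports Defs
begin

text \<open>
  A finite completion time is witnessed by a schedule: slots \<open>0 = s 0 \<le> s 1 \<le> \<dots>\<close> such that every
  receiver gets block \<open>i\<close> within \<open>(s (i - 1), s i]\<close>. If every block boundary of blocklength \<open>c'\<close>,
  measured in packets, is also a boundary of blocklength \<open>c\<close>, then merging the blocks of a
  \<open>c\<close>-schedule gives a \<open>c'\<close>-schedule with the same end; this covers (i) and the multiples in (ii).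

  Otherwise \<open>c' = k c + r\<close> with \<open>0 < r < c\<close> and \<open>k \<ge> 1\<close>. Let \<open>b = min c (m - k c) > r\<close> be the size of
  block \<open>k + 1\<close> under \<open>c\<close>. Receiver 2 is erased exactly during the \<open>b\<close> slots after slot \<open>k c\<close>, and
  all others exactly during the \<open>b\<close> slots after that. Blocklength \<open>c\<close> loses only \<open>b\<close> slots and ends
  at \<open>m + b\<close>. Under \<open>c'\<close>, receiver 2 delays the end of the first block to \<open>k c + b + r\<close>, and
  receiver 1 can start on the remaining \<open>m - c'\<close> packets only after slot \<open>k c + 2 b\<close>, so the
  transmission takes at least \<open>m + 2 b - r > m + b\<close> slots.
\<close>

section \<open>Counting successes and the end of a single block\<close>

lemma successes_mono:
  assumes "s' \<le> s" "t \<le> t'"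
  shows "successes \<omega> j s t \<le> successes \<omega> j s' t'"
  unfolding successes_def by (rule card_mono) (use assms in auto)

lemma successes_split:
  assumes "s \<le> t" "t \<le> u"
  shows "successes \<omega> j s u = successes \<omega> j s t + successes \<omega> j t u"
proof -
  have "{x \<in> {s<..u}. \<omega> j x} = {x \<in> {s<..t}. \<omega> j x} \<union> {x \<in> {t<..u}. \<omega> j x}"
    using assms by auto
  then show ?thesis
    unfolding successes_def by (simp add: card_Un_disjoint disjoint_iff)
qed

lemma successes_le_card:
  assumes "{u \<in> {s<..t}. \<omega> j u} \<subseteq> A" "finite A"
  shows "successes \<omega> j s t \<le> card A"
  unfolding successes_def using assms by (rule card_mono[rotated])

lemma card_le_successes:
  assumes "A \<subseteq> {u \<in> {s<..t}. \<omega> j u}"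
  shows "card A \<le> successes \<omega> j s t"
  unfolding successes_def using assms by (intro card_mono) auto

text \<open>A nonempty set of extended naturals attains its infimum, and the condition on
  \<open>t\<close> is upward closed because success counts grow with the interval.\<close>

lemma block_end_le_iff:
  "block_end n \<omega> b s \<le> enat t \<longleftrightarrow> s \<le> t \<and> (\<forall>j\<in>{1..n}. b \<le> successes \<omega> j s t)"
proof
  assume le: "block_end n \<omega> b s \<le> enat t"
  let ?S = "{enat t |t. s \<le> t \<and> (\<forall>j\<in>{1..n}. b \<le> successes \<omega> j s t)}"
  have "?S \<noteq> {}"
  proof
    assume "?S = {}"
    then have "block_end n \<omega> b s = \<infinity>"
      by (simp only: block_end_def Inf_enat_def simp_thms if_True)
    with le show False by simp
  qed
  then have "(LEAST x. x \<in> ?S) \<in> ?S"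
    unfolding ex_in_conv[symmetric] by (rule LeastI_ex)
  then have "Inf ?S \<in> ?S"
    using \<open>?S \<noteq> {}\<close> by (simp only: Inf_enat_def if_False)
  then obtain t' where t': "block_end n \<omega> b s = enat t'" "s \<le> t'"
    "\<forall>j\<in>{1..n}. b \<le> successes \<omega> j s t'"
    unfolding block_end_def by blast
  with le have "t' \<le> t" by simp
  with t'(2,3) show "s \<le> t \<and> (\<forall>j\<in>{1..n}. b \<le> successes \<omega> j s t)"
    by (auto intro: order.trans[OF _ successes_mono])
next
  assume "s \<le> t \<and> (\<forall>j\<in>{1..n}. b \<le> successes \<omega> j s t)"
  then show "block_end n \<omega> b s \<le> enat t"
    unfolding block_end_def by (intro Inf_lower) blast
qed

section \<open>Schedules as witnesses of finite completion times\<close>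

text \<open>\<open>w i\<close> is the number of packets in the first \<open>i\<close> blocks.\<close>

definition schedule :: "nat \<Rightarrow> realization \<Rightarrow> (nat \<Rightarrow> nat) \<Rightarrow> nat \<Rightarrow> (nat \<Rightarrow> nat) \<Rightarrow> bool" where
  "schedule n \<omega> w N s \<longleftrightarrow> s 0 = 0 \<and>
     (\<forall>i<N. s i \<le> s (Suc i) \<and>
        (\<forall>j\<in>{1..n}. w (Suc i) - w i \<le> successes \<omega> j (s i) (s (Suc i))))"

lemma schedule_mono:
  assumes "schedule n \<omega> w N s" "a \<le> b" "b \<le> N"
  shows "s a \<le> s b"
  using assms(2,3)
proof (induction b rule: dec_induct)
  case (step l)
  then have "s l \<le> s (Suc l)" using assms(1) by (simp add: schedule_def)
  with step show ?case by simp
qed simp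

lemma schedule_successes:
  assumes "schedule n \<omega> w N s" "j \<in> {1..n}" "a \<le> b" "b \<le> N"
  shows "w b - w a \<le> successes \<omega> j (s a) (s b)"
  using assms(3,4)
proof (induction b rule: dec_induct)
  case (step l)
  have "successes \<omega> j (s a) (s (Suc l)) = successes \<omega> j (s a) (s l) + successes \<omega> j (s l) (s (Suc l))"
    using schedule_mono[OF assms(1), of a l] schedule_mono[OF assms(1), of l "Suc l"] step.hyps step.prems
    by (intro successes_split) auto
  moreover have "w (Suc l) - w l \<le> successes \<omega> j (s l) (s (Suc l))"
    using assms(1,2) step.prems unfolding schedule_def by (meson Suc_le_lessD)
  moreover have "w l - w a \<le> successes \<omega> j (s a) (s l)"
    using step.IH step.prems by linarith
  \<comment> \<open>Truncated subtraction satisfies the triangle inequality for arbitrary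
    \<open>w\<close>.\<close>
  ultimately show ?case by linarith
qed simp

text \<open>Ending each block as early as possible is optimal: an earlier start only enlarges the
  window of the next block, so no schedule beats \<open>block_time\<close>.\<close>

lemma block_time_le_iff:
  assumes "\<And>i. i < N \<Longrightarrow> block_size c m (Suc i) = w (Suc i) - w i" "N' \<le> N"
  shows "block_time n \<omega> c m N' \<le> enat t \<longleftrightarrow> (\<exists>s. schedule n \<omega> w N' s \<and> s N' \<le> t)"
  using assms(2)
proof (induction N' arbitrary: t)
  case 0
  then show ?case by (auto simp: schedule_def zero_enat_def intro: exI[of _ "\<lambda>_. 0"])
next
  case (Suc i)
  have size: "block_size c m (Suc i) = w (Suc i) - w i"
    using assms(1) Suc.prems by simp
  show ?case
  proof
    assume le: "block_time n \<omega> c m (Suc i) \<le> enat t"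
    then obtain u where u: "block_time n \<omega> c m i = enat u"
      by (cases "block_time n \<omega> c m i") auto
    with le have t: "u \<le> t" "\<forall>j\<in>{1..n}. w (Suc i) - w i \<le> successes \<omega> j u t"
      by (auto simp: block_end_le_iff size)
    obtain s where s: "schedule n \<omega> w i s" "s i \<le> u"
      using Suc.IH[of u] u Suc.prems by auto
    \<comment> \<open>The schedule may end block \<open>i\<close> before \<open>u\<close>, which
      only adds slots to the next window.\<close>
    have "\<forall>j\<in>{1..n}. w (Suc i) - w i \<le> successes \<omega> j (s i) t"
      using t s(2) by (meson order.refl order.trans successes_mono)
    then have "schedule n \<omega> w (Suc i) (s(Suc i := t))"
      using s t(1) by (auto simp: schedule_def less_Suc_eq)
    then show "\<exists>s. schedule n \<omega> w (Suc i) s \<and> s (Suc i) \<le> t"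
      by (intro exI[of _ "s(Suc i := t)"]) simp
  next
    assume "\<exists>s. schedule n \<omega> w (Suc i) s \<and> s (Suc i) \<le> t"
    then obtain s where s: "schedule n \<omega> w (Suc i) s" "s (Suc i) \<le> t" by blast
    then have "schedule n \<omega> w i s" by (simp add: schedule_def)
    then have "block_time n \<omega> c m i \<le> enat (s i)"
      using Suc.IH Suc.prems by auto
    then obtain u where u: "block_time n \<omega> c m i = enat u" "u \<le> s i"
      by (cases "block_time n \<omega> c m i") auto
    have "\<forall>j\<in>{1..n}. w (Suc i) - w i \<le> successes \<omega> j (s i) (s (Suc i))"
      and "s i \<le> s (Suc i)"
      using s(1) by (auto simp: schedule_def)
    then have "u \<le> t" "\<forall>j\<in>{1..n}. w (Suc i) - w i \<le> successes \<omega> j u t"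
      using u(2) s(2) by (auto intro: order.trans[OF _ successes_mono])
    then show "block_time n \<omega> c m (Suc i) \<le> enat t"
      by (simp add: u block_end_le_iff size)
  qed
qed

section \<open>Number and sizes of blocks\<close>

lemma num_blocks_bounds:
  assumes "1 \<le> c" "1 \<le> m"
  shows "1 \<le> num_blocks c m" "c * (num_blocks c m - 1) < m" "m \<le> c * num_blocks c m"
proof -
  let ?x = "real m / real c"
  have pos: "0 < ?x" using assms by simp
  then show N: "1 \<le> num_blocks c m"
    unfolding num_blocks_def by (metis One_nat_def Suc_leI zero_less_ceiling zero_less_nat_eq)
  have real: "real (num_blocks c m) = of_int \<lceil>?x\<rceil>"
    using pos by (simp add: num_blocks_def)
  have "real m \<le> real c * real (num_blocks c m)"
    using mult_left_mono[OF le_of_int_ceiling[of ?x], of "real c"] assms by (simp add: real)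
  then show "m \<le> c * num_blocks c m"
    by (metis of_nat_le_iff of_nat_mult)
  have "real (num_blocks c m - 1) < ?x"
    using N real ceiling_correct[of ?x] by simp
  then have "real c * real (num_blocks c m - 1) < real m"
    using assms by (simp add: field_simps)
  then show "c * (num_blocks c m - 1) < m"
    by (metis of_nat_less_iff of_nat_mult)
qed

lemma less_num_blocks_iff:
  assumes "1 \<le> c" "1 \<le> m"
  shows "i < num_blocks c m \<longleftrightarrow> c * i < m"
proof
  assume "i < num_blocks c m"
  then have "c * i \<le> c * (num_blocks c m - 1)" by (intro mult_le_mono2) simp
  also have "\<dots> < m" by (rule num_blocks_bounds(2)[OF assms])
  finally show "c * i < m" .
next
  assume "c * i < m"
  then have "c * i < c * num_blocks c m"
    using num_blocks_bounds(3)[OF assms] by (rule less_le_trans)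
  then show "i < num_blocks c m" by simp
qed

text \<open>Capping the cumulative packet count at \<open>m\<close> absorbs the partial last block,
  so full and partial blocks share one formula.\<close>

lemma block_size_eq:
  assumes "1 \<le> c" "1 \<le> m" "i < num_blocks c m"
  shows "block_size c m (Suc i) = min (c * Suc i) m - min (c * i) m"
proof (cases "Suc i < num_blocks c m")
  case True
  then have "c * Suc i < m" using less_num_blocks_iff assms by blast
  with True show ?thesis by (simp add: block_size_def)
next
  case False
  then have "Suc i = num_blocks c m" using assms(3) by simp
  moreover have "m \<le> c * Suc i" using False less_num_blocks_iff[OF assms(1,2)] by (meson not_less)
  moreover have "c * i < m" using less_num_blocks_iff assms by blast
  moreover have "num_blocks c m - 1 = i" using \<open>Suc i = num_blocks c m\<close> by simp
  ultimately show ?thesis using False by (simp add: block_size_def mult.commute min_def)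
qed

lemma total_time_le_iff:
  assumes "1 \<le> c" "1 \<le> m"
  shows "total_time n \<omega> c m \<le> enat t \<longleftrightarrow>
    (\<exists>s. schedule n \<omega> (\<lambda>i. min (c * i) m) (num_blocks c m) s \<and> s (num_blocks c m) \<le> t)"
  unfolding total_time_def
  by (rule block_time_le_iff[OF block_size_eq[OF assms]]) auto

section \<open>Merging blocks\<close>

text \<open>Here \<open>f i\<close> is the number of \<open>c\<close>-blocks that make up the first
  \<open>i\<close> blocks of length \<open>c'\<close>; sampling a \<open>c\<close>-schedule at these
  indices gives a \<open>c'\<close>-schedule.\<close>

lemma total_time_le_by_merging:
  assumes "1 \<le> c" "1 \<le> c'" "1 \<le> m"
    and f: "f 0 = 0" "mono f" "\<And>i. i \<le> num_blocks c' m \<Longrightarrow> f i \<le> num_blocks c m"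
      "\<And>i. i \<le> num_blocks c' m \<Longrightarrow> min (c' * i) m = min (c * f i) m"
  shows "total_time n \<omega> c' m \<le> total_time n \<omega> c m"
proof (cases "total_time n \<omega> c m")
  case (enat t)
  then obtain s where s: "schedule n \<omega> (\<lambda>i. min (c * i) m) (num_blocks c m) s"
    "s (num_blocks c m) \<le> t"
    using total_time_le_iff[OF assms(1,3)] by (metis order.refl)
  have "schedule n \<omega> (\<lambda>i. min (c' * i) m) (num_blocks c' m) (s \<circ> f)"
    unfolding schedule_def
  proof (intro conjI allI impI ballI)
    show "(s \<circ> f) 0 = 0" using s(1) f(1) by (simp add: schedule_def)
    fix i assume i: "i < num_blocks c' m"
    have fi: "f i \<le> f (Suc i)" "f (Suc i) \<le> num_blocks c m"
      using f(2,3) i by (auto simp: mono_def)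
    show "(s \<circ> f) i \<le> (s \<circ> f) (Suc i)"
      using schedule_mono[OF s(1) fi] by simp
    fix j assume "j \<in> {1..n}"
    then show "min (c' * Suc i) m - min (c' * i) m \<le> successes \<omega> j ((s \<circ> f) i) ((s \<circ> f) (Suc i))"
      using schedule_successes[OF s(1) _ fi, of j] f(4)[of i] f(4)[of "Suc i"] i by simp
  qed
  moreover have "(s \<circ> f) (num_blocks c' m) \<le> t"
    using schedule_mono[OF s(1) f(3)[OF order.refl] order.refl] s(2) by simp
  ultimately show ?thesis
    using total_time_le_iff[OF assms(2,3)] enat by metis
qed simp

lemma total_time_le_single_block:
  assumes "1 \<le> c" "1 \<le> c'" "1 \<le> m" "m \<le> c'"
  shows "total_time n \<omega> c' m \<le> total_time n \<omega> c m"
proof (rule total_time_le_by_merging[where f = "\<lambda>i. if i = 0 then 0 else num_blocks c m"])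
  show "mono (\<lambda>i::nat. if i = 0 then 0 else num_blocks c m)" by (auto simp: mono_def)
  fix i assume "i \<le> num_blocks c' m"
  have "m \<le> c' * i" if "i \<noteq> 0" using assms(4) that by (cases i) auto
  then show "min (c' * i) m = min (c * (if i = 0 then 0 else num_blocks c m)) m"
    using num_blocks_bounds(3)[OF assms(1,3)] by auto
qed (use assms in auto)

lemma total_time_le_multiple:
  assumes "1 \<le> c" "1 \<le> k" "1 \<le> m"
  shows "total_time n \<omega> (k * c) m \<le> total_time n \<omega> c m"
\<comment> \<open>The cap matters when the last long block is partial and comprises fewer than
  \<open>k\<close> short ones.\<close>
proof (rule total_time_le_by_merging[where f = "\<lambda>i. min (k * i) (num_blocks c m)"])
  show "mono (\<lambda>i. min (k * i) (num_blocks c m))" by (intro monoI min.mono) auto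
  fix i
  show "min (k * c * i) m = min (c * min (k * i) (num_blocks c m)) m"
  proof (cases "k * i < num_blocks c m")
    case True
    then show ?thesis by (simp add: ac_simps)
  next
    case False
    then have "m \<le> c * (k * i)" using less_num_blocks_iff[OF assms(1,3)] by (meson not_less)
    then show ?thesis using False num_blocks_bounds(3)[OF assms(1,3)] by (simp add: ac_simps)
  qed
qed (use assms in auto)

section \<open>Erasure patterns favouring the shorter blocklength\<close>

definition alternating_erasures :: "nat \<Rightarrow> nat \<Rightarrow> realization" where
  "alternating_erasures a b j u \<longleftrightarrow>
     (if j = 2 then u \<notin> {a<..a + b} else u \<notin> {a + b<..a + 2 * b})"

text \<open>Both bursts fall within block \<open>k + 1\<close>, whose \<open>b\<close> packets then
  take \<open>2 b\<close> slots; all other blocks run without erasures.\<close>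

lemma total_time_alternating_erasures_le:
  assumes "1 \<le> c" "1 \<le> m" "c * k < m" and b: "b = min c (m - c * k)"
  shows "total_time n (alternating_erasures (c * k) b) c m \<le> enat (m + b)"
proof -
  let ?\<omega> = "alternating_erasures (c * k) b"
  let ?W = "\<lambda>i. min (c * i) m"
  let ?N = "num_blocks c m"
  \<comment> \<open>At \<open>i = k + 1\<close> the second branch equals
    \<open>c * k + 2 * b\<close>, the end of the second burst.\<close>
  define s where "s i = (if i \<le> k then c * i else ?W i + b)" for i
  have WSk: "?W (Suc k) = c * k + b" using assms(3) b by auto
  have kN: "k < ?N" using assms less_num_blocks_iff by blast
  have W_mono: "?W i \<le> ?W i'" if "i \<le> i'" for i i'
    using that by (intro min.mono mult_le_mono2) auto
  have "schedule n ?\<omega> ?W ?N s"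
    unfolding schedule_def
  proof (intro conjI allI impI ballI)
    show "s 0 = 0" by (simp add: s_def)
    fix i assume "i < ?N"
    consider "i < k" | "i = k" | "k < i" by linarith
    then have "s i \<le> s (Suc i) \<and> (\<forall>j. ?W (Suc i) - ?W i \<le> successes ?\<omega> j (s i) (s (Suc i)))"
    proof cases
      case 1
      have "c * Suc i \<le> c * k" using 1 by (intro mult_le_mono2) simp
      then have "card {c * i<..c * Suc i} \<le> successes ?\<omega> j (c * i) (c * Suc i)" for j
        by (intro card_le_successes) (auto simp: alternating_erasures_def)
      then show ?thesis using 1 \<open>c * Suc i \<le> c * k\<close> assms(3)
        by (auto simp: s_def min_def)
    next
      case 2
      then have s: "s i = c * k" "s (Suc i) = c * k + 2 * b"
        using WSk by (auto simp: s_def)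
      \<comment> \<open>Receiver 2 collects its packets in the second half of the window, the others
        in the first half.\<close>
      have "b \<le> successes ?\<omega> j (c * k) (c * k + 2 * b)" for j
      proof (cases "j = 2")
        case True
        then have "card {c * k + b<..c * k + 2 * b} \<le> successes ?\<omega> j (c * k) (c * k + 2 * b)"
          by (intro card_le_successes) (auto simp: alternating_erasures_def)
        then show ?thesis by simp
      next
        case False
        then have "card {c * k<..c * k + b} \<le> successes ?\<omega> j (c * k) (c * k + 2 * b)"
          by (intro card_le_successes) (auto simp: alternating_erasures_def)
        then show ?thesis by simp
      qed
      moreover have "?W (Suc i) - ?W i = b" using 2 WSk assms(3) by auto
      ultimately show ?thesis unfolding s by simp
    next
      case 3
      then have s: "s i = ?W i + b" "s (Suc i) = ?W (Suc i) + b" by (auto simp: s_def)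
      have "c * k + 2 * b \<le> s i" using W_mono[of "Suc k" i] 3 WSk s(1) by simp
      then have "card {s i<..s (Suc i)} \<le> successes ?\<omega> j (s i) (s (Suc i))" for j
        by (intro card_le_successes) (auto simp: alternating_erasures_def)
      then show ?thesis using W_mono[of i "Suc i"] by (simp add: s)
    qed
    then show "s i \<le> s (Suc i)"
      and "?W (Suc i) - ?W i \<le> successes ?\<omega> j (s i) (s (Suc i))" for j
      by auto
  qed
  moreover have "s ?N \<le> m + b" using kN by (simp add: s_def)
  ultimately show ?thesis using total_time_le_iff[OF assms(1,2)] by blast
qed

lemma total_time_alternating_erasures_gt:
  assumes "2 \<le> n" "0 < r" "r < b" "a + r < m" "a + b \<le> m"
  shows "enat (m + b) < total_time n (alternating_erasures a b) (a + r) m"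
proof (rule ccontr)
  let ?\<omega> = "alternating_erasures a b"
  let ?N = "num_blocks (a + r) m"
  assume "\<not> enat (m + b) < total_time n ?\<omega> (a + r) m"
  then have "total_time n ?\<omega> (a + r) m \<le> enat (m + b)" by simp
  moreover have pos: "1 \<le> a + r" "1 \<le> m" using assms by auto
  ultimately obtain s where s: "schedule n ?\<omega> (\<lambda>i. min ((a + r) * i) m) ?N s"
    and end_le: "s ?N \<le> m + b"
    using total_time_le_iff by blast
  have N: "1 \<le> ?N" "m \<le> (a + r) * ?N" using num_blocks_bounds[OF pos] by auto
  have "a + r \<le> successes ?\<omega> 2 0 (s 1)"
    using schedule_successes[OF s, of 2 0 1] assms N s by (simp add: schedule_def)
  also have "\<dots> \<le> card ({0<..a} \<union> {a + b<..s 1})"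
    by (rule successes_le_card) (auto simp: alternating_erasures_def)
  also have "\<dots> \<le> a + (s 1 - (a + b))"
    using card_Un_le[of "{0<..a}" "{a + b<..s 1}"] by simp
  \<comment> \<open>Since \<open>0 < r\<close>, the truncated difference is positive and can be
    resolved.\<close>
  finally have s1: "a + b + r \<le> s 1" using assms(2) by simp
  have "m - (a + r) \<le> successes ?\<omega> 1 (s 1) (s ?N)"
    using schedule_successes[OF s, of 1 1 ?N] assms N by simp
  \<comment> \<open>The second block starts after slot \<open>a + b\<close>, so receiver 1 first
    sits out the rest of its burst. Only \<open>m - (a + b)\<close> slots remain, too few as
    \<open>r < b\<close>.\<close>
  also have "\<dots> \<le> card {a + 2 * b<..m + b}"
    by (rule successes_le_card) (use s1 end_le in \<open>auto simp: alternating_erasures_def\<close>)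
  finally show False using assms by simp
qed

lemma ex_total_time_less:
  assumes "2 \<le> n" "1 \<le> c" "c < c'" "c' < m" "\<not> c dvd c'"
  shows "\<exists>\<omega>. total_time n \<omega> c m < total_time n \<omega> c' m"
proof -
  define k where "k = c' div c"
  define r where "r = c' mod c"
  define b where "b = min c (m - c * k)"
  have c': "c' = c * k + r" by (simp add: k_def r_def)
  have r: "0 < r" "r < c" using assms by (auto simp: r_def dvd_eq_mod_eq_0)
  \<comment> \<open>If block \<open>k + 1\<close> is partial, then \<open>b = m - c * k\<close>, and
    \<open>c' < m\<close> still gives \<open>r < b\<close>.\<close>
  have "c * k < m" "r < b" "c * k + b \<le> m" using r c' assms(4) by (auto simp: b_def)
  then have "total_time n (alternating_erasures (c * k) b) c m \<le> enat (m + b)"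
    and "enat (m + b) < total_time n (alternating_erasures (c * k) b) c' m"
    using total_time_alternating_erasures_le[OF assms(2) _ _ b_def]
      total_time_alternating_erasures_gt[of n r b "c * k" m] assms r(1) c' by auto
  then show ?thesis by (meson order.strict_trans1)
qed

text \<open>The converse in (ii) needs a second receiver: with \<open>n = 1\<close> every
  blocklength finishes at the \<open>m\<close>-th success, so the inequality holds for all
  \<open>c'\<close>.\<close>

theorem proposition19:
  fixes n c c' m :: nat and q :: "nat \<Rightarrow> real"
  assumes "1 \<le> n"
    and "\<forall>j\<in>{1..n}. 0 \<le> q j \<and> q j \<le> 1"
    and "1 \<le> c" and "c < c'" and "1 \<le> m"
  shows "(m \<le> c' \<longrightarrow> (\<forall>\<omega>. total_time n \<omega> c' m \<le> total_time n \<omega> c m)) \<and>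
    (c' < m \<longrightarrow>
      (2 \<le> n \<longrightarrow>
        ((\<forall>\<omega>. total_time n \<omega> c' m \<le> total_time n \<omega> c m) \<longleftrightarrow> (\<exists>k\<ge>2. c' = k * c))) \<and>
      ((\<exists>k\<ge>2. c' = k * c) \<longrightarrow> (\<forall>\<omega>. total_time n \<omega> c' m \<le> total_time n \<omega> c m)))"
proof -
  have "total_time n \<omega> c' m \<le> total_time n \<omega> c m" if "m \<le> c'" for \<omega>
    using total_time_le_single_block assms that by simp
  moreover have "total_time n \<omega> c' m \<le> total_time n \<omega> c m" if "\<exists>k\<ge>2. c' = k * c" for \<omega>
    using total_time_le_multiple assms that by auto
  moreover have "\<exists>k\<ge>2. c' = k * c"
    if "2 \<le> n" "c' < m" "\<forall>\<omega>. total_time n \<omega> c' m \<le> total_time n \<omega> c m"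
  proof -
    have "c dvd c'"
      using ex_total_time_less[of n c c' m] assms that by (meson not_less)
    then obtain k where k: "c' = k * c" by (metis dvdE mult.commute)
    then have "k \<noteq> 0" "k \<noteq> 1" using assms by auto
    then have "2 \<le> k" by simp
    with k show ?thesis by blast
  qed
  ultimately show ?thesis by blast
qed

end
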